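(* Let $n\ge 1$. There is a bijection between the set of binary even LCD codes of length $n$ and the set of simple graphs on $n$ vertices (with vertex set $\{1,\ldots,n\}$) whose adjacency matrix $A$ is idempotent over $\mathbb{F}_2$ (that is, $A^2=A$ over $\mathbb{F}_2$), and this bijection preserves equivalence: two codes are permutation equivalent if and only if the corresponding graphs are isomorphic.
   Context: A binary code of length $n$ is a linear subspace $C\subseteq\mathbb{F}_2^n$ (the zero code is allowed). Its dual $C^\perp$ is taken with respect to $\langle x,y\rangle=\sum_i x_iy_i$. $C$ is LCD (linear complementary dual) if $C\cap C^\perp=\{0\}$. $C$ is even if every codeword has even Hamming weight. Two codes $C_1,C_2\subseteq\mathbb{F}_2^n$ are permutation equivalent if $C_2=\{cP: c\in C_1\}$ for some permutation matrix $P$. Simple graphs have no loops or multiple edges; two graphs are isomorphic if their adjacency matrices $A,A'$ satisfy $A'=P^TAP$ for some permutation matrix $P$. *)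

theory Defs
  imports "HOL-Analysis.Analysis" "HOL-Library.Z2"
begin

text \<open>
  The length \<open>n\<close> is the cardinality of the finite index type \<open>'n\<close>, and \<open>bit\<close> is the two-element
  field. Since types are nonempty, \<open>n \<ge> 1\<close>. The index type also plays the role of the vertex
  set \<open>{1, \<dots>, n}\<close>.
\<close>

definition binary_code :: "(bit ^ 'n::finite) set \<Rightarrow> bool" where
  "binary_code C \<longleftrightarrow> vec.subspace C"

text \<open>The inner product of the library is only available over the reals.\<close>

definition bit_dot :: "bit ^ 'n::finite \<Rightarrow> bit ^ 'n \<Rightarrow> bit" where
  "bit_dot x y = (\<Sum>i\<in>UNIV. x $ i * y $ i)"

definition dual_code :: "(bit ^ 'n::finite) set \<Rightarrow> (bit ^ 'n) set" where
  "dual_code C = {x. \<forall>c\<in>C. bit_dot x c = 0}"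

definition LCD :: "(bit ^ 'n::finite) set \<Rightarrow> bool" where
  "LCD C \<longleftrightarrow> C \<inter> dual_code C = {0}"

definition hamming_weight :: "bit ^ 'n::finite \<Rightarrow> nat" where
  "hamming_weight x = card {i. x $ i \<noteq> 0}"

definition even_code :: "(bit ^ 'n::finite) set \<Rightarrow> bool" where
  "even_code C \<longleftrightarrow> (\<forall>c\<in>C. even (hamming_weight c))"

definition permutation_matrix :: "'a::semiring_1 ^ 'n ^ 'n::finite \<Rightarrow> bool" where
  "permutation_matrix P \<longleftrightarrow>
     (\<exists>\<sigma>. \<sigma> permutes UNIV \<and> P = (\<chi> i j. if j = \<sigma> i then 1 else 0))"

definition permutation_equivalent ::
    "(bit ^ 'n::finite) set \<Rightarrow> (bit ^ 'n) set \<Rightarrow> bool" where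
  "permutation_equivalent C1 C2 \<longleftrightarrow>
     (\<exists>P. permutation_matrix P \<and> C2 = {c v* P | c. c \<in> C1})"

text \<open>A simple graph on the vertex set \<open>UNIV :: 'n set\<close> is given by its set of edges.\<close>

definition simple_graph :: "'n::finite set set \<Rightarrow> bool" where
  "simple_graph E \<longleftrightarrow> (\<forall>e\<in>E. card e = 2)"

definition adjacency_matrix :: "'n::finite set set \<Rightarrow> 'a::semiring_1 ^ 'n ^ 'n" where
  "adjacency_matrix E = (\<chi> i j. if {i, j} \<in> E then 1 else 0)"

text \<open>
  Isomorphism refers to the integral adjacency matrix, whereas idempotence refers to its
  reduction modulo 2.
\<close>

definition graph_isomorphic :: "'n::finite set set \<Rightarrow> 'n set set \<Rightarrow> bool" where
  "graph_isomorphic E E' \<longleftrightarrow>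
     (\<exists>P :: int ^ 'n ^ 'n. permutation_matrix P \<and>
        adjacency_matrix E' = transpose P ** adjacency_matrix E ** P)"

definition even_LCD_codes :: "(bit ^ 'n::finite) set set" where
  "even_LCD_codes = {C. binary_code C \<and> LCD C \<and> even_code C}"

definition idempotent_graphs :: "'n::finite set set set" where
  "idempotent_graphs =
     {E. simple_graph E \<and>
         (adjacency_matrix E :: bit ^ 'n ^ 'n) ** adjacency_matrix E = adjacency_matrix E}"

end

theory Submission
  imports Defs
begin

text \<open>
  A code \<open>C\<close> is LCD precisely when the whole space is the orthogonal direct sum of \<open>C\<close> and its
  dual, that is, when there is an orthogonal projection onto \<open>C\<close>. The matrix of this projection is
  the unique symmetric idempotent matrix with row space \<open>C\<close>. Its diagonal entries are
  the squares \<open>A\<^sub>i \<cdot> A\<^sub>i\<close> of its rows, and so they vanish if and only if \<open>C\<close> is even; symmetric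
  matrices over the two-element field with zero diagonal are adjacency matrices. By
  uniqueness, a coordinate permutation maps one code to another if and only if
  it maps the one projection to the other.
\<close>

text \<open>As simp rules these rewrite sums and products in \<open>bit\<close> to bit operations,
  where the ring and sum laws used below no longer match.\<close>

declare add_bit_eq_xor [simp del] mult_bit_eq_and [simp del]

section \<open>Symmetric idempotent matrices\<close>

definition row_space :: "'a::semiring_1 ^ 'n ^ 'm \<Rightarrow> ('a ^ 'n) set" where
  "row_space A = range (\<lambda>x. x v* A)"

lemma row_space_idempotent:
  fixes A :: "'a::comm_semiring_1 ^ 'n ^ 'n"
  assumes "A ** A = A"
  shows "c \<in> row_space A \<longleftrightarrow> c v* A = c"
proof
  assume "c \<in> row_space A"
  then obtain x where "c = x v* A"
    by (auto simp: row_space_def)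
  then show "c v* A = c"
    using assms by (simp add: vector_matrix_mul_assoc)
next
  assume "c v* A = c"
  then show "c \<in> row_space A"
    unfolding row_space_def by (metis rangeI)
qed

lemma vector_matrix_mult_eqI:
  fixes A B :: "'a::comm_semiring_1 ^ 'n ^ 'm"
  assumes "\<And>x. x v* A = x v* B"
  shows "A = B"
proof -
  have "transpose A = transpose B"
    using assms by (subst matrix_eq) simp
  then show ?thesis
    by (metis transpose_transpose)
qed

text \<open>Every \<open>x v* B\<close> lies in the row space of \<open>A\<close>, on which the
  idempotent \<open>A\<close> acts as the identity.\<close>

lemma row_space_subset_imp_absorb:
  fixes A B :: "'a::comm_semiring_1 ^ 'n ^ 'n"
  assumes "A ** A = A" "row_space B \<subseteq> row_space A"
  shows "B ** A = B"
proof -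
  have "x v* (B ** A) = x v* B" for x
    using assms row_space_idempotent[OF assms(1), of "x v* B"]
    by (auto simp: row_space_def vector_matrix_mul_assoc)
  then show ?thesis
    by (rule vector_matrix_mult_eqI)
qed

text \<open>An orthogonal projection is determined by its image. Absorption in both directions gives
  \<open>B ** A = B\<close> and \<open>A ** B = A\<close>; transposing the first gives
  \<open>A ** B = B\<close>.\<close>

lemma symmetric_idempotent_eqI:
  fixes A B :: "'a::comm_semiring_1 ^ 'n ^ 'n"
  assumes "A ** A = A" "transpose A = A" "B ** B = B" "transpose B = B"
    and "row_space A = row_space B"
  shows "A = B"
  by (metis assms matrix_transpose_mul order_refl row_space_subset_imp_absorb)

lemma transpose_eq_iff: "transpose A = A \<longleftrightarrow> (\<forall>i j. A $ i $ j = A $ j $ i)"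
  by (auto simp: transpose_def vec_eq_iff)

section \<open>Coordinate permutations\<close>

definition permute_vec :: "('n \<Rightarrow> 'n) \<Rightarrow> 'a ^ 'n \<Rightarrow> 'a ^ 'n" where
  "permute_vec \<tau> x = (\<chi> i. x $ \<tau> i)"

definition permute_mat :: "('n \<Rightarrow> 'n) \<Rightarrow> 'a ^ 'n ^ 'n \<Rightarrow> 'a ^ 'n ^ 'n" where
  "permute_mat \<tau> A = (\<chi> i j. A $ \<tau> i $ \<tau> j)"

lemma sum_permutation_row:
  fixes f :: "'n::finite \<Rightarrow> 'a::semiring_1"
  assumes "\<sigma> permutes UNIV"
  shows "(\<Sum>i\<in>UNIV. f i * (if j = \<sigma> i then 1 else 0)) = f (inv \<sigma> j)"
    and "(\<Sum>i\<in>UNIV. (if j = \<sigma> i then 1 else 0) * f i) = f (inv \<sigma> j)"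
proof -
  have "j = \<sigma> i \<longleftrightarrow> inv \<sigma> j = i" for i
    using permutes_inv_eq[OF assms] by metis
  then show "(\<Sum>i\<in>UNIV. f i * (if j = \<sigma> i then 1 else 0)) = f (inv \<sigma> j)"
    "(\<Sum>i\<in>UNIV. (if j = \<sigma> i then 1 else 0) * f i) = f (inv \<sigma> j)"
    by (simp_all add: if_distrib[of "\<lambda>x. _ * x"] if_distrib[of "\<lambda>x. x * _"] cong: if_cong)
qed

text \<open>Column \<open>j\<close> of the matrix of \<open>\<sigma>\<close> has its 1 in row
  \<open>inv \<sigma> j\<close>, so multiplication by it reindexes along
  \<open>inv \<sigma>\<close>. Inversion maps permutations onto permutations, which allows the
  inverse to be renamed \<open>\<tau>\<close>.\<close>

lemma ex_permutation_matrix_iff: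
  fixes Q :: "'a::semiring_1 ^ 'n ^ 'n::finite \<Rightarrow> bool"
  assumes "\<And>\<sigma>. \<sigma> permutes UNIV \<Longrightarrow> Q (\<chi> i j. if j = \<sigma> i then 1 else 0) \<longleftrightarrow> R (inv \<sigma>)"
  shows "(\<exists>P. permutation_matrix P \<and> Q P) \<longleftrightarrow> (\<exists>\<tau>. \<tau> permutes UNIV \<and> R \<tau>)"
proof
  show "\<exists>\<tau>. \<tau> permutes UNIV \<and> R \<tau>" if "\<exists>P. permutation_matrix P \<and> Q P"
    using that assms permutes_inv unfolding permutation_matrix_def by blast
  show "\<exists>P. permutation_matrix P \<and> Q P" if "\<exists>\<tau>. \<tau> permutes UNIV \<and> R \<tau>"
    using that assms permutes_inv permutes_inv_inv unfolding permutation_matrix_def by metis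
qed

lemma permutation_equivalent_iff:
  "permutation_equivalent C1 C2 \<longleftrightarrow> (\<exists>\<tau>. \<tau> permutes UNIV \<and> C2 = permute_vec \<tau> ` C1)"
  unfolding permutation_equivalent_def
proof (rule ex_permutation_matrix_iff)
  fix \<sigma> :: "'a \<Rightarrow> 'a" assume "\<sigma> permutes UNIV"
  then have "c v* (\<chi> i j. if j = \<sigma> i then 1 else 0) = permute_vec (inv \<sigma>) c" for c :: "bit ^ 'a"
    by (simp add: vector_matrix_mult_def permute_vec_def sum_permutation_row)
  then show "(C2 = {c v* (\<chi> i j. if j = \<sigma> i then 1 else 0) |c. c \<in> C1}) =
      (C2 = permute_vec (inv \<sigma>) ` C1)"
    by (auto simp: image_def)
qed

text \<open>The right-hand side does not mention the semiring, so the equation can be moved from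
  \<open>int\<close> to \<open>bit\<close>.\<close>

lemma permute_adjacency_matrix_iff:
  "(adjacency_matrix E' :: 'a::semiring_1 ^ 'n ^ 'n) = permute_mat \<tau> (adjacency_matrix E) \<longleftrightarrow>
    (\<forall>i j. {i, j} \<in> E' \<longleftrightarrow> {\<tau> i, \<tau> j} \<in> E)"
  by (auto simp: adjacency_matrix_def permute_mat_def vec_eq_iff split: if_splits)

lemma graph_isomorphic_iff:
  "graph_isomorphic E E' \<longleftrightarrow> (\<exists>\<tau>. \<tau> permutes UNIV \<and>
    (adjacency_matrix E' :: bit ^ 'n ^ 'n::finite) = permute_mat \<tau> (adjacency_matrix E))"
  unfolding graph_isomorphic_def
proof (rule ex_permutation_matrix_iff)
  fix \<sigma> :: "'n \<Rightarrow> 'n" assume "\<sigma> permutes UNIV"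
  then have "transpose P ** A ** P = permute_mat (inv \<sigma>) A"
    if "P = (\<chi> i j. if j = \<sigma> i then 1 else 0)" for A P :: "int ^ 'n ^ 'n"
    unfolding that
    by (simp add: matrix_matrix_mult_def transpose_def permute_mat_def sum_permutation_row)
  then show "((adjacency_matrix E' :: int ^ 'n ^ 'n) =
      transpose (\<chi> i j. if j = \<sigma> i then 1 else 0) ** adjacency_matrix E **
        (\<chi> i j. if j = \<sigma> i then 1 else 0)) =
      ((adjacency_matrix E' :: bit ^ 'n ^ 'n) = permute_mat (inv \<sigma>) (adjacency_matrix E))"
    by (simp add: permute_adjacency_matrix_iff)
qed

lemma permute_mat_mult:
  assumes "\<tau> permutes UNIV"
  shows "permute_mat \<tau> A ** permute_mat \<tau> B = permute_mat \<tau> (A ** B)"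
  using sum.permute[OF assms, of "\<lambda>k. A $ \<tau> _ $ k * B $ k $ \<tau> _"]
  by (simp add: permute_mat_def matrix_matrix_mult_def vec_eq_iff o_def)

lemma permute_vec_mult:
  assumes "\<tau> permutes UNIV"
  shows "permute_vec \<tau> x v* permute_mat \<tau> A = permute_vec \<tau> (x v* A)"
  using sum.permute[OF assms, of "\<lambda>k. x $ k * A $ k $ \<tau> _"]
  by (simp add: permute_mat_def permute_vec_def vector_matrix_mult_def vec_eq_iff o_def)

text \<open>Since \<open>permute_vec \<tau>\<close> is onto, the coefficient vectors may be taken in
  permuted form, and the permutation then moves past the product.\<close>

lemma row_space_permute_mat:
  fixes A :: "'a::semiring_1 ^ 'n ^ 'n::finite"
  assumes "\<tau> permutes UNIV"
  shows "row_space (permute_mat \<tau> A) = permute_vec \<tau> ` row_space A"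
proof -
  have "permute_vec \<tau> (permute_vec (inv \<tau>) x) = x" for x :: "'a ^ 'n"
    using permutes_inverses[OF assms] by (simp add: permute_vec_def)
  then have "range (permute_vec \<tau> :: 'a ^ 'n \<Rightarrow> 'a ^ 'n) = UNIV"
    by (metis surjI)
  then have "row_space (permute_mat \<tau> A) =
      (\<lambda>x. x v* permute_mat \<tau> A) ` range (permute_vec \<tau>)"
    by (simp add: row_space_def)
  then show ?thesis
    by (simp add: row_space_def image_image permute_vec_mult[OF assms])
qed

section \<open>Orthogonal projections onto LCD codes\<close>

lemma bit_dot_commute: "bit_dot x y = bit_dot y x"
  by (simp add: bit_dot_def mult.commute)

lemma bit_dot_add: "bit_dot x (y + z) = bit_dot x y + bit_dot x z"
  by (simp add: bit_dot_def distrib_left sum.distrib)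

lemma bit_dot_axis [simp]: "bit_dot x (axis i 1) = x $ i"
  by (simp add: bit_dot_def axis_def if_distrib[of "\<lambda>x. _ * x"] cong: if_cong)

lemma bit_dot_row: "bit_dot (A $ i) x = (A *v x) $ i"
  by (simp add: bit_dot_def matrix_vector_mult_def)

lemma bit_dot_vector_matrix: "bit_dot c (x v* A) = bit_dot (A *v c) x"
proof -
  have "bit_dot c (x v* A) = (\<Sum>j\<in>UNIV. \<Sum>i\<in>UNIV. c $ j * (x $ i * A $ i $ j))"
    by (simp add: bit_dot_def vector_matrix_mult_def sum_distrib_left)
  also have "\<dots> = (\<Sum>i\<in>UNIV. \<Sum>j\<in>UNIV. c $ j * (x $ i * A $ i $ j))"
    by (rule sum.swap)
  also have "\<dots> = bit_dot (A *v c) x"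
    by (simp add: bit_dot_def matrix_vector_mult_def sum_distrib_left sum_distrib_right mult_ac)
  finally show ?thesis .
qed

lemma bit_dot_self: "bit_dot x x = of_nat (hamming_weight x)"
proof -
  have "bit_dot x x = (\<Sum>i\<in>UNIV. of_bool (x $ i \<noteq> 0))"
    unfolding bit_dot_def by (rule sum.cong) (auto simp: of_bool_def)
  then show ?thesis
    by (simp add: hamming_weight_def)
qed

lemma even_hamming_weight_iff: "even (hamming_weight x) \<longleftrightarrow> bit_dot x x = 0"
proof -
  have "(of_nat n :: bit) = 0 \<longleftrightarrow> even n" for n
    by (induction n) auto
  then show ?thesis
    by (simp add: bit_dot_self)
qed

text \<open>This is where linear algebra enters: it yields both the double dual inclusion and the
  splitting of the space for an LCD code.\<close>

lemma subspace_separation: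
  assumes "vec.subspace S" "y \<notin> S"
  obtains w where "\<And>s. s \<in> S \<Longrightarrow> bit_dot w s = 0" "bit_dot w y \<noteq> 0"
proof -
  obtain B where B: "B \<subseteq> S" "vec.independent B" "S \<subseteq> vec.span B"
    by (rule vec.maximal_independent_subset)
  have "y \<notin> vec.span B"
    using B(1) assms vec.span_minimal by blast
  then have "vec.independent (insert y B)"
    using B(2) by (rule vec.independent_insertI)
  \<comment> \<open>The map \<open>g\<close> kills a basis of \<open>S\<close> and fixes
    \<open>y\<close>. Any row of its matrix that corresponds to a nonzero coordinate of
    \<open>y\<close> can serve as \<open>w\<close>.\<close>
  from vec.linear_independent_extend[OF this, of "\<lambda>b. if b = y then y else 0"]
  obtain g where g: "Vector_Spaces.linear (*s) (*s) g"
      "\<forall>x\<in>insert y B. g x = (if x = y then y else 0)"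
    by blast
  have mat: "matrix g *v x = g x" for x
    using g(1) by (rule matrix_works)
  have "g s = 0" if "s \<in> S" for s
  proof (rule vec.linear_eq_0_on_span[OF g(1)])
    show "g x = 0" if "x \<in> B" for x
      using g(2) that B(1) assms(2) by auto
    show "s \<in> vec.span B"
      using that B(3) by blast
  qed
  moreover have "y \<noteq> 0"
    using assms vec.subspace_0 by metis
  then obtain k where "y $ k \<noteq> 0"
    by (auto simp: vec_eq_iff)
  ultimately show thesis
    using g(2) by (intro that[of "matrix g $ k"]) (auto simp: bit_dot_row mat)
qed

lemma subspace_dual_code: "vec.subspace (dual_code C)"
proof (rule vec.subspaceI)
  show "0 \<in> dual_code C"
    by (simp add: dual_code_def bit_dot_def)
  show "x + y \<in> dual_code C" if "x \<in> dual_code C" "y \<in> dual_code C" for x y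
    using that by (simp add: dual_code_def bit_dot_def distrib_right sum.distrib)
  show "c *s x \<in> dual_code C" if "x \<in> dual_code C" for c x
    using that by (simp add: dual_code_def bit_dot_def mult.assoc flip: sum_distrib_left)
qed

lemma dual_code_dual_code:
  assumes "vec.subspace C"
  shows "dual_code (dual_code C) \<subseteq> C"
proof
  fix y assume y: "y \<in> dual_code (dual_code C)"
  show "y \<in> C"
  proof (rule ccontr)
    assume "y \<notin> C"
    then obtain w where "\<And>s. s \<in> C \<Longrightarrow> bit_dot w s = 0" "bit_dot w y \<noteq> 0"
      using subspace_separation assms by blast
    then show False
      using y by (auto simp: dual_code_def bit_dot_commute)
  qed
qed

text \<open>A vector outside the sum would be separated from it by some \<open>w\<close> orthogonal
  to both \<open>C\<close> and its dual. Such a \<open>w\<close> lies in the dual and, by the double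
  dual inclusion, in \<open>C\<close>, hence is 0.\<close>

lemma LCD_decomposition:
  assumes "vec.subspace C" "LCD C"
  obtains c d where "c \<in> C" "d \<in> dual_code C" "v = c + d"
proof -
  let ?S = "{c + d |c d. c \<in> C \<and> d \<in> dual_code C}"
  have "vec.subspace ?S"
    using assms(1) subspace_dual_code by (rule vec.subspace_sums)
  have sub: "C \<subseteq> ?S" "dual_code C \<subseteq> ?S"
    using vec.subspace_0[OF assms(1)] vec.subspace_0[OF subspace_dual_code[of C]]
    by (force, force)
  have "v \<in> ?S"
  proof (rule ccontr)
    assume "v \<notin> ?S"
    then obtain w where w: "\<And>s. s \<in> ?S \<Longrightarrow> bit_dot w s = 0" "bit_dot w v \<noteq> 0"
      using subspace_separation \<open>vec.subspace ?S\<close> by blast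
    have dualI: "w \<in> dual_code D" if "D \<subseteq> ?S" for D
      unfolding dual_code_def using w(1) subsetD[OF that] by blast
    have "w \<in> dual_code C" "w \<in> dual_code (dual_code C)"
      using sub by (auto intro: dualI)
    then have "w = 0"
      using dual_code_dual_code[OF assms(1)] assms(2) by (auto simp: LCD_def)
    then show False
      using w(2) by (simp add: bit_dot_def)
  qed
  then show thesis
    using that by blast
qed

lemma LCD_projection:
  assumes "vec.subspace C" "LCD C"
  obtains A where "transpose A = A" "A ** A = A" "row_space A = C"
proof -
  have "\<exists>c. c \<in> C \<and> (\<exists>d \<in> dual_code C. axis i 1 = c + d)" for i
    using LCD_decomposition[OF assms, of "axis i 1"] by metis
  \<comment> \<open>The rows \<open>p i\<close> of the projection matrix are the components in
    \<open>C\<close> of the unit vectors.\<close>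
  then obtain p q where p: "\<And>i. p i \<in> C" and q: "\<And>i. q i \<in> dual_code C"
    and pq: "\<And>i. axis i 1 = p i + q i"
    by metis
  define A where "A = (\<chi> i. p i)"
  have dot_p: "bit_dot c (p i) = c $ i" if "c \<in> C" for c i
  proof -
    have "bit_dot c (q i) = 0"
      using q that by (auto simp: dual_code_def bit_dot_commute)
    then have "bit_dot c (p i) = bit_dot c (axis i 1)"
      by (simp add: pq bit_dot_add)
    then show ?thesis
      by simp
  qed
  \<comment> \<open>Taking \<open>c = p i\<close> in \<open>dot_p\<close> shows that
    \<open>A\<close> is the Gram matrix of its rows, which makes it symmetric.\<close>
  have A: "A $ i $ j = bit_dot (p i) (p j)" for i j
    using dot_p[OF p] by (simp add: A_def)
  then have sym: "transpose A = A"
    by (simp add: transpose_eq_iff bit_dot_commute)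
  have fixed: "c v* A = c" if "c \<in> C" for c
  proof -
    have "(A *v c) $ i = c $ i" for i
      using dot_p[OF that, of i] by (simp add: bit_dot_commute A_def flip: bit_dot_row)
    then have "A *v c = c"
      by (simp add: vec_eq_iff)
    then show ?thesis
      using sym by (metis transpose_matrix_vector)
  qed
  have inC: "x v* A \<in> C" for x
  proof -
    have "x v* A = (\<Sum>i\<in>UNIV. x $ i *s p i)"
      by (simp add: vec_eq_iff vector_matrix_mult_def A_def)
    then show ?thesis
      using p assms(1) by (simp add: vec.subspace_sum vec.subspace_scale)
  qed
  have "row_space A = C"
    using fixed inC unfolding row_space_def by (metis image_subset_iff rangeI subsetI subset_antisym)
  moreover have "x v* (A ** A) = x v* A" for x
    using fixed[OF inC] by (simp add: vector_matrix_mul_assoc)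
  then have "A ** A = A"
    by (rule vector_matrix_mult_eqI)
  ultimately show thesis
    using sym that by blast
qed

text \<open>For \<open>c\<close> in the intersection, \<open>A *v c = c\<close>, so the pairing of
  \<open>c\<close> with \<open>axis i 1 v* A\<close> is the coordinate \<open>c $ i\<close>; it
  vanishes because \<open>c\<close> is in the dual.\<close>

lemma LCD_row_space:
  assumes "transpose A = A" "A ** A = A"
  shows "LCD (row_space A)"
proof -
  have "c = 0" if "c \<in> row_space A" "c \<in> dual_code (row_space A)" for c
  proof -
    have "bit_dot c (axis i 1 v* A) = 0" for i
      using that(2) by (simp add: dual_code_def row_space_def)
    moreover have "A *v c = c"
      using that(1) assms by (metis row_space_idempotent transpose_matrix_vector)
    ultimately show ?thesis
      by (simp add: bit_dot_vector_matrix vec_eq_iff)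
  qed
  moreover have "0 \<in> row_space A"
    unfolding row_space_def by (metis rangeI vector_matrix_mult_0)
  ultimately show ?thesis
    by (auto simp: LCD_def dual_code_def bit_dot_def)
qed

lemma subspace_row_space: "vec.subspace (row_space (A :: 'a::field ^ 'n ^ 'm))"
proof -
  have "row_space A = range ((*v) (transpose A))"
    by (simp add: row_space_def)
  then show ?thesis
    by (metis vec.subspace_UNIV vec.subspace_image)
qed

lemma even_row_space_iff:
  assumes "transpose A = A" "A ** A = A"
  shows "even_code (row_space A) \<longleftrightarrow> (\<forall>i. A $ i $ i = 0)"
proof -
  have row: "axis i 1 v* A = A $ i" for i
    by (simp add: vector_matrix_mult_def axis_def vec_eq_iff if_distrib[of "\<lambda>x. x * _"]
        cong: if_cong)
  \<comment> \<open>By symmetry row \<open>i\<close> is also column \<open>i\<close>, so this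
    product is a diagonal entry of \<open>A ** A\<close>.\<close>
  have diag: "bit_dot (A $ i) (A $ i) = A $ i $ i" for i
  proof -
    have "bit_dot (A $ i) (A $ i) = (A ** A) $ i $ i"
      using assms(1) by (simp add: bit_dot_def matrix_matrix_mult_def transpose_eq_iff)
    then show ?thesis
      by (simp add: assms(2))
  qed
  show ?thesis
  proof
    assume "even_code (row_space A)"
    then have "bit_dot (A $ i) (A $ i) = 0" for i
      by (metis even_code_def even_hamming_weight_iff rangeI row row_space_def)
    then show "\<forall>i. A $ i $ i = 0"
      by (simp add: diag)
  next
    assume *: "\<forall>i. A $ i $ i = 0"
    \<comment> \<open>Over the two-element field \<open>c \<cdot> c\<close> is linear in \<open>c\<close>, so it suffices to consider the rows.\<close>
    have idem: "x * x = x" for x :: bit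
      by (cases x) auto
    have square: "bit_dot c c = bit_dot c 1" for c :: "bit ^ 'a"
      unfolding bit_dot_def by (rule sum.cong) (auto simp: idem)
    \<comment> \<open>Here \<open>1\<close> is the all-ones vector. Its product with row
      \<open>i\<close> equals the product of that row with itself, that is, the diagonal
      entry.\<close>
    have "A *v 1 = 0"
      using * by (simp add: vec_eq_iff diag flip: bit_dot_row square)
    then have "bit_dot (x v* A) (x v* A) = 0" for x
      by (simp add: square bit_dot_commute[of _ 1] bit_dot_vector_matrix)
        (simp add: bit_dot_def)
    then show "even_code (row_space A)"
      by (auto simp: even_code_def even_hamming_weight_iff row_space_def)
  qed
qed

section \<open>Adjacency matrices\<close>

lemma transpose_adjacency_matrix: "transpose (adjacency_matrix E) = adjacency_matrix E"
  by (simp add: transpose_eq_iff adjacency_matrix_def insert_commute)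

lemma adjacency_matrix_diag: "simple_graph E \<Longrightarrow> adjacency_matrix E $ i $ i = 0"
  by (auto simp: simple_graph_def adjacency_matrix_def)

lemma adjacency_matrix_eqD:
  assumes "simple_graph E" "simple_graph E'"
    and "(adjacency_matrix E :: 'a::semiring_1 ^ 'n ^ 'n) = adjacency_matrix E'"
  shows "E = E'"
proof -
  have "{i, j} \<in> E \<longleftrightarrow> {i, j} \<in> E'" for i j
    using assms(3) by (auto simp: adjacency_matrix_def vec_eq_iff) (metis zero_neq_one)+
  moreover have "\<exists>i j. e = {i, j}" if "e \<in> E \<union> E'" for e
    using that assms(1,2) card_2_iff unfolding simple_graph_def by (metis Un_iff)
  ultimately show ?thesis
    by (metis UnCI subsetI subset_antisym)
qed

lemma symmetric_zero_diag_adjacency_matrix: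
  fixes A :: "bit ^ 'n ^ 'n::finite"
  assumes "transpose A = A" "\<And>i. A $ i $ i = 0"
  obtains E where "simple_graph E" "adjacency_matrix E = A"
proof
  let ?E = "{{i, j} |i j. A $ i $ j = 1}"
  have "i \<noteq> j" if "A $ i $ j = 1" for i j
    using that assms(2) by auto
  then show "simple_graph ?E"
    by (auto simp: simple_graph_def card_insert_if)
  \<comment> \<open>Symmetry is needed because the edge may have been generated by the pair
    \<open>(j, i)\<close>.\<close>
  have "{i, j} \<in> ?E \<longleftrightarrow> A $ i $ j = 1" for i j
    using assms(1) by (auto simp: transpose_eq_iff doubleton_eq_iff)
  then show "adjacency_matrix ?E = A"
    by (auto simp: adjacency_matrix_def vec_eq_iff)
qed

section \<open>The bijection\<close>

text \<open>The correspondence is set up from graphs to codes, where it has an explicit formula; the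
  required bijection is its inverse.\<close>

definition graph_code :: "'n::finite set set \<Rightarrow> (bit ^ 'n) set" where
  "graph_code E = row_space (adjacency_matrix E)"

lemma idempotent_graph_eqI:
  assumes "E \<in> idempotent_graphs" "E' \<in> idempotent_graphs" "graph_code E = graph_code E'"
  shows "E = E'"
proof (rule adjacency_matrix_eqD)
  show "simple_graph E" "simple_graph E'"
    using assms by (simp_all add: idempotent_graphs_def)
  show "(adjacency_matrix E :: bit ^ 'a ^ 'a) = adjacency_matrix E'"
    by (rule symmetric_idempotent_eqI)
      (use assms in \<open>simp_all add: idempotent_graphs_def graph_code_def
        transpose_adjacency_matrix\<close>)
qed

lemma graph_code_even_LCD:
  assumes "E \<in> idempotent_graphs"
  shows "graph_code E \<in> even_LCD_codes"
  using assms
  by (auto simp: idempotent_graphs_def even_LCD_codes_def graph_code_def binary_code_def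
      subspace_row_space LCD_row_space transpose_adjacency_matrix even_row_space_iff
      adjacency_matrix_diag)

lemma even_LCD_graph_code:
  assumes "C \<in> even_LCD_codes"
  obtains E where "E \<in> idempotent_graphs" "graph_code E = C"
proof -
  have C: "vec.subspace C" "LCD C" "even_code C"
    using assms by (auto simp: even_LCD_codes_def binary_code_def)
  from C(1,2) obtain A where A: "transpose A = A" "A ** A = A" "row_space A = C"
    by (rule LCD_projection)
  then have "A $ i $ i = 0" for i
    using C(3) even_row_space_iff by blast
  with A(1) obtain E where "simple_graph E" "adjacency_matrix E = A"
    using symmetric_zero_diag_adjacency_matrix by blast
  with A that show thesis
    by (auto simp: idempotent_graphs_def graph_code_def)
qed

lemma bij_betw_graph_code: "bij_betw graph_code idempotent_graphs even_LCD_codes"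
proof (rule bij_betw_imageI)
  show "inj_on graph_code idempotent_graphs"
    by (rule inj_onI) (rule idempotent_graph_eqI)
  show "graph_code ` idempotent_graphs = even_LCD_codes"
    using graph_code_even_LCD even_LCD_graph_code by blast
qed

lemma permutation_equivalent_graph_code_iff:
  fixes E E' :: "'n::finite set set"
  assumes "E \<in> idempotent_graphs" "E' \<in> idempotent_graphs"
  shows "permutation_equivalent (graph_code E) (graph_code E') \<longleftrightarrow> graph_isomorphic E E'"
proof -
  let ?A = "adjacency_matrix E :: bit ^ 'n ^ 'n"
  let ?A' = "adjacency_matrix E' :: bit ^ 'n ^ 'n"
  have "graph_code E' = permute_vec \<tau> ` graph_code E \<longleftrightarrow> ?A' = permute_mat \<tau> ?A"
    if \<tau>: "\<tau> permutes UNIV" for \<tau>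
  proof -
    have "row_space ?A' = row_space (permute_mat \<tau> ?A) \<longleftrightarrow> ?A' = permute_mat \<tau> ?A"
    proof
      assume rows: "row_space ?A' = row_space (permute_mat \<tau> ?A)"
      \<comment> \<open>The permuted matrix is again a symmetric idempotent, so uniqueness of the
        projection turns equality of row spaces into equality of matrices.\<close>
      have sym: "transpose (permute_mat \<tau> ?A) = permute_mat \<tau> ?A"
        using transpose_adjacency_matrix[of E, where 'a = bit]
        by (simp add: transpose_eq_iff permute_mat_def)
      show "?A' = permute_mat \<tau> ?A"
        by (rule symmetric_idempotent_eqI)
          (use assms rows sym in \<open>simp_all add: idempotent_graphs_def
            transpose_adjacency_matrix permute_mat_mult[OF \<tau>]\<close>)
    qed simp
    then show ?thesis
      by (simp add: graph_code_def row_space_permute_mat[OF \<tau>])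
  qed
  then show ?thesis
    unfolding permutation_equivalent_iff graph_isomorphic_iff by blast
qed

theorem theorem3p2:
  shows "\<exists>\<Phi> :: (bit ^ 'n::finite) set \<Rightarrow> 'n set set.
    bij_betw \<Phi> even_LCD_codes idempotent_graphs \<and>
    (\<forall>C1 \<in> even_LCD_codes. \<forall>C2 \<in> even_LCD_codes.
       permutation_equivalent C1 C2 \<longleftrightarrow> graph_isomorphic (\<Phi> C1) (\<Phi> C2))"
proof (intro exI conjI ballI)
  \<comment> \<open>This sends a code to the graph whose adjacency matrix is the orthogonal
    projection onto the code.\<close>
  let ?\<Phi> = "inv_into idempotent_graphs (graph_code :: 'n set set \<Rightarrow> _)"
  show bij: "bij_betw ?\<Phi> even_LCD_codes idempotent_graphs"
    using bij_betw_graph_code by (rule bij_betw_inv_into)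
  show "permutation_equivalent C1 C2 \<longleftrightarrow> graph_isomorphic (?\<Phi> C1) (?\<Phi> C2)"
    if "C1 \<in> even_LCD_codes" "C2 \<in> even_LCD_codes" for C1 C2
    using that permutation_equivalent_graph_code_iff[of "?\<Phi> C1" "?\<Phi> C2"]
    by (simp add: bij_betw_apply[OF bij] bij_betw_inv_into_right[OF bij_betw_graph_code])
qed

end
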